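(* Let $n$ be a positive integer. If $P \subseteq \mathbb{R}^n$ is closed and uncountable, then there are a $C^1$ arc $A \subseteq \mathbb{R}^n$ and a Cantor set $Q$ with $Q \subseteq P \cap A$. Hence, for every $\varepsilon > 0$, there is an $\varepsilon$-directed arc $B \subseteq \mathbb{R}^n$ such that $P \cap B$ is uncountable.
   Context: An arc in $\mathbb{R}^n$ is a set homeomorphic to a closed bounded interval $[a,b] \subset \mathbb{R}$ ($a<b$). A path is a homeomorphism $g$ mapping a compact interval onto an arc. For $k \ge 1$, an arc $A$ is $C^k$ iff $A$ is the image of some path $g$ which is a $C^k$ function into $\mathbb{R}^n$ and satisfies $g'(t) \ne 0$ for all $t$ in its domain. A Cantor set is a space homeomorphic to $\{0,1\}^{\omega}$. Let $\rho : \mathbb{R}^n \setminus \{0\} \to S^{n-1}$ be $\rho(x) = x/\|x\|$. A set $A \subseteq \mathbb{R}^n$ is $\varepsilon$-directed iff for some $v \in S^{n-1}$, whenever $x,y$ are distinct points of $A$, $\|\rho(x-y) - v\| \le \varepsilon$ or $\|\rho(x-y)+v\| \le \varepsilon$. *)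

theory Defs
  imports "HOL-Analysis.Analysis"
begin

definition is_arc :: "'a::topological_space set \<Rightarrow> bool" where
  "is_arc A \<longleftrightarrow> (\<exists>a b::real. a < b \<and> A homeomorphic {a..b})"

text \<open>Derivatives are taken within \<open>S\<close>, so at the endpoints of a compact interval they are
  one-sided.\<close>

primrec Ck_on :: "nat \<Rightarrow> (real \<Rightarrow> 'a::real_normed_vector) \<Rightarrow> real set \<Rightarrow> bool" where
  "Ck_on 0 g S \<longleftrightarrow> continuous_on S g"
| "Ck_on (Suc k) g S \<longleftrightarrow>
     (\<exists>g'. (\<forall>t\<in>S. (g has_vector_derivative g' t) (at t within S)) \<and> Ck_on k g' S)"

text \<open>Meant for \<open>k \<ge> 1\<close>; only then is \<^const>\<open>vector_derivative\<close> guaranteed to be an actual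
  derivative of \<open>g\<close>.\<close>

definition is_Ck_arc :: "nat \<Rightarrow> 'a::real_normed_vector set \<Rightarrow> bool" where
  "is_Ck_arc k A \<longleftrightarrow> is_arc A \<and>
     (\<exists>a b g. a < b \<and> (\<exists>h. homeomorphism {a..b} A g h) \<and> Ck_on k g {a..b} \<and>
        (\<forall>t\<in>{a..b}. vector_derivative g (at t within {a..b}) \<noteq> 0))"

text \<open>The type \<^typ>\<open>nat \<Rightarrow> bool\<close> carries the product topology and \<^typ>\<open>bool\<close> the discrete
  one.\<close>

definition is_Cantor_set :: "'a::topological_space set \<Rightarrow> bool" where
  "is_Cantor_set Q \<longleftrightarrow> Q homeomorphic (UNIV :: (nat \<Rightarrow> bool) set)"

text \<open>For \<open>x \<noteq> 0\<close>, \<open>sgn x = x /\<^sub>R norm x\<close> is the radial projection of \<open>x\<close> to the unit sphere.\<close>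

definition directed_set :: "real \<Rightarrow> (real^'n) set \<Rightarrow> bool" where
  "directed_set \<epsilon> A \<longleftrightarrow>
     (\<exists>v\<in>sphere 0 1. \<forall>x\<in>A. \<forall>y\<in>A. x \<noteq> y \<longrightarrow>
        norm (sgn (x - y) - v) \<le> \<epsilon> \<or> norm (sgn (x - y) + v) \<le> \<epsilon>)"

end

theory Submission
  imports Defs
begin

text \<open>
  The idea is to find inside \<open>P\<close> a Cantor set that is a graph over a coordinate axis and along
  which the secant directions converge; such a graph is differentiable in Whitney's sense and
  therefore lies on a \<open>C\<^sup>1\<close> curve.

  Directions are measured by the \<open>slope\<close> of a pair of points with respect to a basis vector \<open>e\<close>: the
  difference vector rescaled so that its \<open>e\<close>-component is \<open>1\<close>. It is symmetric in the two points,
  so no sign has to be chosen. After passing to the perfect kernel \<open>X\<close> of \<open>P\<close>, a pigeonhole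
  argument (\<open>persistent_pigeonhole\<close>) replaces Ramsey-type theorems: if every
  open portion of \<open>X\<close> contains pairs with slope in a bounded set \<open>A\<close>, and \<open>A\<close> is covered by
  finitely many small pieces, then in some smaller portion one of these pieces alone has the same
  property. Repeating this while splitting portions in two gives a Cantor scheme of
  portions \<open>U\<close> together with shrinking sets of slopes \<open>A\<close>, such that two points that separate at a
  node have a slope in the set \<open>A\<close> of that node (\<open>Cantor_scheme\<close>). Along a branch the sets \<open>A\<close>
  shrink to one vector, which is the derivative there, and the difference quotients
  converge to it uniformly.

  The resulting Cantor set is the graph of a function on a compact set \<open>K\<close> of reals with a
  derivative \<open>d\<close> on \<open>K\<close> to which the difference quotients converge uniformly. To extend it to an
  interval (\<open>Whitney_extension_C1\<close>), extend \<open>d\<close> continuously and subtract the integral: this leaves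
  a function whose derivative vanishes on \<open>K\<close>, and such a function can be continued across each
  gap of \<open>K\<close> by a rescaled smoothstep (\<open>C1_extension_with_critical_set\<close>). Correcting the
  \<open>e\<close>-component so that it equals the parameter makes the curve injective with nonzero velocity.

  Finally, by uniform differentiability a \<open>C\<^sup>1\<close> arc is a finite union of \<open>\<epsilon>\<close>-directed subarcs, one
  of which must meet \<open>P\<close> in an uncountable set (\<open>directed_subarc\<close>).
\<close>

section \<open>Properties of pairs that persist in every open portion\<close>

text \<open>Shrinking \<open>U\<close> cannot avoid the pairs in \<open>C\<close> as long as it keeps a point of \<open>X\<close>. This plays
  the role of homogeneity in a partition theorem.\<close>

definition persistent :: "'a::topological_space set \<Rightarrow> 'a set \<Rightarrow> ('a \<times> 'a) set \<Rightarrow> bool" where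
  "persistent X U C \<longleftrightarrow> open U \<and> U \<inter> X \<noteq> {} \<and>
     (\<forall>V. open V \<longrightarrow> V \<subseteq> U \<longrightarrow> V \<inter> X \<noteq> {} \<longrightarrow> (\<exists>x\<in>V \<inter> X. \<exists>y\<in>V \<inter> X. (x, y) \<in> C))"

lemma persistent_subset:
  assumes "persistent X U C" "open V" "V \<subseteq> U" "V \<inter> X \<noteq> {}"
  shows "persistent X V C"
  using assms unfolding persistent_def by (meson order_trans)

text \<open>If \<open>D j\<close> does not persist in \<open>U\<close>, some portion contains no pair from it. There \<open>C - D j\<close>
  still persists and is covered by the remaining sets.\<close>

lemma persistent_pigeonhole:
  assumes "finite I" "persistent X U C" "C \<subseteq> (\<Union>i\<in>I. D i)"
  shows "\<exists>i\<in>I. \<exists>V\<subseteq>U. persistent X V (D i)"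
  using assms
proof (induction I arbitrary: U C)
  case empty
  then show ?case
    unfolding persistent_def by auto
next
  case (insert j I)
  show ?case
  proof (cases "persistent X U (D j)")
    case True
    then show ?thesis by blast
  next
    case False
    moreover have "open U" "U \<inter> X \<noteq> {}"
      using insert.prems(1) unfolding persistent_def by blast+
    ultimately obtain V where V: "open V" "V \<subseteq> U" "V \<inter> X \<noteq> {}"
      "\<not> (\<exists>x\<in>V \<inter> X. \<exists>y\<in>V \<inter> X. (x, y) \<in> D j)"
      unfolding persistent_def by meson
    have VC: "persistent X V C"
      by (rule persistent_subset[OF insert.prems(1) V(1-3)])
    have "\<exists>x\<in>W \<inter> X. \<exists>y\<in>W \<inter> X. (x, y) \<in> C - D j" if W: "open W" "W \<subseteq> V" "W \<inter> X \<noteq> {}" for W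
    proof -
      obtain x y where "x \<in> W \<inter> X" "y \<in> W \<inter> X" "(x, y) \<in> C"
        using VC W unfolding persistent_def by blast
      with V(4) W(2) show ?thesis by blast
    qed
    with V(1,3) have "persistent X V (C - D j)"
      unfolding persistent_def by blast
    moreover have "C - D j \<subseteq> (\<Union>i\<in>I. D i)"
      using insert.prems(2) by auto
    ultimately obtain i W where "i \<in> I" "W \<subseteq> V" "persistent X W (D i)"
      using insert.IH by blast
    with V(2) show ?thesis
      by (meson insertI2 order_trans)
  qed
qed

section \<open>Slopes\<close>

definition slope :: "'a::real_inner \<Rightarrow> 'a \<Rightarrow> 'a \<Rightarrow> 'a" where
  "slope e x y = (x - y) /\<^sub>R ((x - y) \<bullet> e)"

definition slope_pairs :: "'a::real_inner \<Rightarrow> 'a set \<Rightarrow> ('a \<times> 'a) set" where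
  "slope_pairs e A = {(x, y). (x - y) \<bullet> e \<noteq> 0 \<and> slope e x y \<in> A}"

lemma slope_commute: "slope e x y = slope e y x"
proof -
  have "x - y = - (y - x)" "(x - y) \<bullet> e = - ((y - x) \<bullet> e)"
    by (simp_all add: inner_diff_left)
  then show ?thesis
    unfolding slope_def by (simp only: inverse_minus_eq scaleR_minus_left scaleR_minus_right minus_minus)
qed

lemma slope_pairs_commute: "(x, y) \<in> slope_pairs e A \<longleftrightarrow> (y, x) \<in> slope_pairs e A"
  unfolding slope_pairs_def using slope_commute[of e x y] by (auto simp: inner_diff_left)

lemma open_slope_pairs:
  assumes "open A"
  shows "open (slope_pairs e A)"
proof -
  let ?S = "{p. (fst p - snd p) \<bullet> e \<noteq> 0}"
  have "open (- {p. (fst p - snd p) \<bullet> e = 0})"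
    by (intro open_Compl closed_Collect_eq continuous_intros)
  then have S: "open ?S" by (simp add: Collect_neg_eq)
  have "continuous_on ?S (\<lambda>p. slope e (fst p) (snd p))"
    unfolding slope_def by (intro continuous_intros) auto
  then have "open (?S \<inter> (\<lambda>p. slope e (fst p) (snd p)) -` A)"
    using S assms by (rule continuous_open_preimage)
  moreover have "?S \<inter> (\<lambda>p. slope e (fst p) (snd p)) -` A = slope_pairs e A"
    by (auto simp: slope_pairs_def)
  ultimately show ?thesis by simp
qed

text \<open>A bounded set of slopes is covered by finitely many small balls, and by the pigeonhole
  principle a single ball persists somewhere.\<close>

lemma refine_slopes:
  fixes A :: "'a::euclidean_space set"
  assumes "persistent X U (slope_pairs e A)" "open A" "bounded A" "0 < r"
  shows "\<exists>V\<subseteq>U. \<exists>B\<subseteq>A. persistent X V (slope_pairs e B) \<and> open B \<and> (\<forall>a\<in>B. \<forall>b\<in>B. dist a b \<le> r)"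
proof -
  have "compact (closure A)" using assms(3) by simp
  then obtain k where k: "finite k" "closure A \<subseteq> (\<Union>x\<in>k. ball x (r/2))"
    using \<open>0 < r\<close> unfolding compact_eq_totally_bounded by (meson half_gt_zero)
  then have "A \<subseteq> (\<Union>x\<in>k. ball x (r/2))" using closure_subset[of A] by blast
  then have "slope_pairs e A \<subseteq> (\<Union>x\<in>k. slope_pairs e (A \<inter> ball x (r/2)))"
    unfolding slope_pairs_def by blast
  then obtain x V where "V \<subseteq> U" "persistent X V (slope_pairs e (A \<inter> ball x (r/2)))"
    using persistent_pigeonhole[OF k(1) assms(1)] by blast
  moreover have "dist a b \<le> r" if "a \<in> ball x (r/2)" "b \<in> ball x (r/2)" for a b
    using that dist_triangle3[of a b x] by simp
  moreover have "open (A \<inter> ball x (r/2))" using assms(2) by blast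
  ultimately show ?thesis
    by (meson IntD2 inf_le1)
qed

section \<open>A Cantor scheme with converging slopes\<close>

text \<open>A node of level \<open>m\<close> is a pair of a portion and a set of slopes, both of diameter at most
  \<open>(1/2)^m\<close>; the slopes persist, so that the node can be split again.\<close>

definition scheme_node :: "'a::euclidean_space set \<Rightarrow> 'a \<Rightarrow> nat \<Rightarrow> 'a set \<times> 'a set \<Rightarrow> bool" where
  "scheme_node X e m S \<longleftrightarrow> persistent X (fst S) (slope_pairs e (snd S)) \<and> open (snd S) \<and>
     (\<forall>x\<in>fst S. \<forall>y\<in>fst S. dist x y \<le> (1/2)^m) \<and> (\<forall>a\<in>snd S. \<forall>b\<in>snd S. dist a b \<le> (1/2)^m)"

lemma scheme_nodeD:
  assumes "scheme_node X e m S"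
  shows "open (fst S)" "fst S \<inter> X \<noteq> {}" "\<forall>x\<in>fst S. \<forall>y\<in>fst S. dist x y \<le> (1/2)^m"
    "snd S \<noteq> {}" "\<forall>a\<in>snd S. \<forall>b\<in>snd S. dist a b \<le> (1/2)^m"
proof -
  show p: "open (fst S)" "fst S \<inter> X \<noteq> {}" "\<forall>x\<in>fst S. \<forall>y\<in>fst S. dist x y \<le> (1/2)^m"
    "\<forall>a\<in>snd S. \<forall>b\<in>snd S. dist a b \<le> (1/2)^m"
    using assms unfolding scheme_node_def persistent_def by blast+
  obtain p where "p \<in> slope_pairs e (snd S)"
    using assms p(1,2) unfolding scheme_node_def persistent_def by blast
  then show "snd S \<noteq> {}" unfolding slope_pairs_def by auto
qed

lemma scheme_node_refine:
  fixes A :: "'a::euclidean_space set"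
  assumes "persistent X U (slope_pairs e A)" "open A" "bounded A" "x \<in> U" "x \<in> X"
  shows "\<exists>S. scheme_node X e m S \<and> closure (fst S) \<subseteq> U \<and> snd S \<subseteq> A"
proof -
  have "open U" using assms unfolding persistent_def by blast
  then obtain r where r: "0 < r" "cball x r \<subseteq> U"
    using assms(4) open_contains_cball by blast
  define q where "q = min r ((1/2)^m/2)"
  have q: "0 < q" "q \<le> r" "q \<le> (1/2)^m/2" using r(1) by (auto simp: q_def)
  have U: "ball x q \<subseteq> U" using r(2) q(2) by (meson ball_subset_cball order_trans subset_ball)
  then have "persistent X (ball x q) (slope_pairs e A)"
    using U q(1) assms(5) centre_in_ball[of x q] by (intro persistent_subset[OF assms(1)]) blast+
  then obtain V B where V: "V \<subseteq> ball x q" "B \<subseteq> A" "persistent X V (slope_pairs e B)" "open B"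
    "\<forall>a\<in>B. \<forall>b\<in>B. dist a b \<le> (1/2)^m"
    using refine_slopes[OF _ assms(2,3), of X "ball x q" e "(1/2)^m"] by auto
  have "dist y z \<le> (1/2)^m" if "y \<in> V" "z \<in> V" for y z
  proof -
    have "dist x y < q" "dist x z < q" using that V(1) by auto
    then show ?thesis using dist_triangle3[of y z x] q(3) by linarith
  qed
  moreover have "closure V \<subseteq> cball x q"
    using V(1) by (meson ball_subset_cball closed_cball closure_minimal order_trans)
  then have "closure V \<subseteq> U" using r(2) q(2) by (meson order_trans subset_cball)
  ultimately show ?thesis using V
    by (intro exI[of _ "(V, B)"]) (auto simp: scheme_node_def)
qed

lemma bounded_if_dist_le: "(\<forall>a\<in>A. \<forall>b\<in>A. dist a b \<le> r) \<Longrightarrow> bounded A"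
  unfolding bounded_def by (cases "A = {}") blast+

text \<open>A single pair with slope in the set \<open>A\<close> of the node suffices: since \<open>A\<close> is open, small
  neighbourhoods of the two points only have slopes in \<open>A\<close> between them. Two points with a slope
  have different \<open>e\<close>-components, so these neighbourhoods are disjoint.\<close>

lemma scheme_node_split:
  assumes "scheme_node X e m S"
  shows "\<exists>T. (\<forall>b. scheme_node X e (Suc m) (T b) \<and> closure (fst (T b)) \<subseteq> fst S \<and> snd (T b) \<subseteq> snd S) \<and>
     (\<forall>x\<in>fst (T False). \<forall>y\<in>fst (T True). (x, y) \<in> slope_pairs e (snd S))"
proof -
  let ?U = "fst S" and ?A = "snd S"
  have S: "persistent X ?U (slope_pairs e ?A)" "open ?A" "bounded ?A" "open ?U"
    using assms bounded_if_dist_le unfolding scheme_node_def persistent_def by blast+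
  then obtain x y where xy: "x \<in> ?U \<inter> X" "y \<in> ?U \<inter> X" "(x, y) \<in> slope_pairs e ?A"
    unfolding persistent_def by blast
  obtain O0 O1 where O: "open O0" "open O1" "(x, y) \<in> O0 \<times> O1" "O0 \<times> O1 \<subseteq> slope_pairs e ?A"
    using open_prod_elim[OF open_slope_pairs[OF S(2)] xy(3)] by metis
  have p0: "persistent X (O0 \<inter> ?U) (slope_pairs e ?A)" and p1: "persistent X (O1 \<inter> ?U) (slope_pairs e ?A)"
    using O xy S(4) by (auto intro!: persistent_subset[OF S(1)])
  obtain T0 where T0: "scheme_node X e (Suc m) T0" "closure (fst T0) \<subseteq> O0 \<inter> ?U" "snd T0 \<subseteq> ?A"
    using scheme_node_refine[OF p0 S(2,3), of x] xy O by blast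
  obtain T1 where T1: "scheme_node X e (Suc m) T1" "closure (fst T1) \<subseteq> O1 \<inter> ?U" "snd T1 \<subseteq> ?A"
    using scheme_node_refine[OF p1 S(2,3), of y] xy O by blast
  have "fst T0 \<subseteq> O0" "fst T1 \<subseteq> O1"
    using T0(2) T1(2) closure_subset by blast+
  then have "(u, v) \<in> slope_pairs e ?A" if "u \<in> fst T0" "v \<in> fst T1" for u v
    using that O(4) by blast
  then show ?thesis using T0 T1
    by (intro exI[of _ "\<lambda>b. if b then T1 else T0"]) auto
qed

text \<open>Taking for \<open>e\<close> the axis along which \<open>x - y\<close> is largest gives a slope of norm at most the
  dimension. The bounded slopes for the various axes therefore cover all pairs of distinct points,
  and by the pigeonhole principle one axis works for a whole portion.\<close>

lemma scheme_root:
  fixes X :: "'a::euclidean_space set"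
  assumes "X \<noteq> {}" "\<And>x. x \<in> X \<Longrightarrow> x islimpt X"
  shows "\<exists>e\<in>Basis. \<exists>S. scheme_node X e 0 S"
proof -
  let ?r = "real DIM('a) + 1"
  let ?D = "\<lambda>e::'a. slope_pairs e (ball 0 ?r)"
  have "\<exists>x\<in>V \<inter> X. \<exists>y\<in>V \<inter> X. x \<noteq> y" if "open V" "V \<inter> X \<noteq> {}" for V
  proof -
    obtain x where "x \<in> V" "x \<in> X" using \<open>V \<inter> X \<noteq> {}\<close> by blast
    with assms(2) \<open>open V\<close> show ?thesis unfolding islimpt_def by (metis IntI)
  qed
  then have "persistent X UNIV {(x, y). x \<noteq> y}"
    using assms(1) unfolding persistent_def by auto
  moreover have "{(x, y). x \<noteq> y} \<subseteq> (\<Union>e\<in>Basis. ?D e)"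
  proof safe
    fix x y :: 'a assume "x \<noteq> y"
    obtain e where e: "e \<in> Basis" "\<And>b. b \<in> Basis \<Longrightarrow> \<bar>(x - y) \<bullet> b\<bar> \<le> \<bar>(x - y) \<bullet> e\<bar>"
    proof -
      have *: "finite ((\<lambda>b. \<bar>(x - y) \<bullet> b\<bar>) ` (Basis::'a set))" "(\<lambda>b. \<bar>(x - y) \<bullet> b\<bar>) ` (Basis::'a set) \<noteq> {}"
        by auto
      from Max_in[OF *] obtain e where "e \<in> Basis" "Max ((\<lambda>b. \<bar>(x - y) \<bullet> b\<bar>) ` Basis) = \<bar>(x - y) \<bullet> e\<bar>"
        by blast
      with Max_ge[OF *(1)] show ?thesis by (intro that) auto
    qed
    have "norm (x - y) \<le> (\<Sum>b\<in>Basis. \<bar>(x - y) \<bullet> b\<bar>)" by (rule norm_le_l1)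
    also have "\<dots> \<le> real DIM('a) * \<bar>(x - y) \<bullet> e\<bar>"
      using sum_bounded_above[of "Basis :: 'a set" "\<lambda>b. \<bar>(x - y) \<bullet> b\<bar>"] e(2) by simp
    finally have n: "norm (x - y) \<le> real DIM('a) * \<bar>(x - y) \<bullet> e\<bar>" .
    have nz: "(x - y) \<bullet> e \<noteq> 0" using n \<open>x \<noteq> y\<close> by auto
    then have "norm (slope e x y) \<le> real DIM('a)"
      unfolding slope_def norm_scaleR using n by (simp add: field_simps)
    then have "(x, y) \<in> ?D e" using nz by (simp add: slope_pairs_def)
    with e(1) show "(x, y) \<in> (\<Union>e\<in>Basis. ?D e)" by blast
  qed
  ultimately obtain e U where e: "e \<in> Basis" "persistent X U (?D e)"
    using persistent_pigeonhole[OF finite_Basis, of X UNIV _ ?D] by blast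
  then obtain x where "x \<in> U" "x \<in> X" unfolding persistent_def by blast
  then show ?thesis using scheme_node_refine[OF e(2)] e(1) by fastforce
qed

text \<open>Walking down the tree along a sequence of choices \<open>\<beta>\<close> avoids indexing the nodes by finite
  words; that the \<open>m\<close>-th node depends on the first \<open>m\<close> choices only is \<open>branch_cong\<close>.\<close>

primrec branch :: "(nat \<Rightarrow> 's \<Rightarrow> bool \<Rightarrow> 's) \<Rightarrow> 's \<Rightarrow> (nat \<Rightarrow> bool) \<Rightarrow> nat \<Rightarrow> 's" where
  "branch step S \<beta> 0 = S"
| "branch step S \<beta> (Suc m) = step m (branch step S \<beta> m) (\<beta> m)"

lemma branch_cong: "(\<And>i. i < m \<Longrightarrow> \<beta> i = \<gamma> i) \<Longrightarrow> branch step S \<beta> m = branch step S \<gamma> m"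
  by (induction m) auto

lemma compact_Cantor_space: "compact (UNIV :: (nat \<Rightarrow> bool) set)"
proof -
  have "compact_space (euclidean :: bool topology)"
    by (simp add: compact_space_def finite_imp_compact)
  then have "compact_space (product_topology (\<lambda>_. euclidean :: bool topology) (UNIV :: nat set))"
    by (simp add: compact_space_product_topology)
  then show ?thesis
    by (simp add: compact_space_def euclidean_product_topology)
qed

lemma open_cylinder: "open {\<beta> :: nat \<Rightarrow> bool. \<forall>i<m. \<beta> i = \<gamma> i}"
proof -
  have "open ((\<lambda>\<beta> :: nat \<Rightarrow> bool. \<beta> i) -` {\<gamma> i})" for i
    by (intro open_vimage) (auto simp: open_discrete)
  then have "open (\<Inter>i\<in>{..<m}. (\<lambda>\<beta> :: nat \<Rightarrow> bool. \<beta> i) -` {\<gamma> i})"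
    by (intro open_INT) auto
  moreover have "(\<Inter>i\<in>{..<m}. (\<lambda>\<beta> :: nat \<Rightarrow> bool. \<beta> i) -` {\<gamma> i}) = {\<beta>. \<forall>i<m. \<beta> i = \<gamma> i}"
    by auto
  ultimately show ?thesis by simp
qed

lemma closure_dist_le:
  assumes "\<forall>a\<in>A. \<forall>b\<in>A. dist a b \<le> r" "x \<in> A" "y \<in> closure A"
  shows "dist x y \<le> r"
proof -
  have "closure A \<subseteq> cball x r"
    using assms by (intro closure_minimal) auto
  with assms(3) show ?thesis by auto
qed

text \<open>The point \<open>c \<beta>\<close> and the slope \<open>d \<beta>\<close> are limits along the branch \<open>\<beta>\<close>. If \<open>\<beta>\<close> and \<open>\<gamma>\<close> first
  differ at level \<open>k\<close>, the slope between their points lies in the \<open>k\<close>-th slope set of \<open>\<beta>\<close>, hence within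
  \<open>(1/2)^k\<close> of \<open>d \<beta>\<close>. The modulus is uniform because by compactness points that are close
  enough lie in a common portion of level \<open>m\<close>, which forces \<open>k \<ge> m\<close>.\<close>

lemma Cantor_scheme:
  fixes X :: "'a::euclidean_space set"
  assumes "closed X" "X \<noteq> {}" "\<And>x. x \<in> X \<Longrightarrow> x islimpt X"
  obtains e c d where "e \<in> Basis" "continuous_on UNIV c" "range c \<subseteq> X" "inj (\<lambda>\<beta>. c \<beta> \<bullet> e)"
    "\<And>\<epsilon>. 0 < \<epsilon> \<Longrightarrow> \<exists>\<delta>>0. \<forall>\<beta> \<gamma> :: nat \<Rightarrow> bool. dist (c \<beta>) (c \<gamma>) < \<delta> \<longrightarrow>
       norm (c \<gamma> - c \<beta> - ((c \<gamma> - c \<beta>) \<bullet> e) *\<^sub>R d \<beta>) \<le> \<epsilon> * \<bar>(c \<gamma> - c \<beta>) \<bullet> e\<bar>"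
proof -
  obtain e S0 where e: "e \<in> Basis" and S0: "scheme_node X e 0 S0"
    using scheme_root[OF assms(2,3)] by blast
  have "\<exists>T. scheme_node X e m S \<longrightarrow>
     (\<forall>b. scheme_node X e (Suc m) (T b) \<and> closure (fst (T b)) \<subseteq> fst S \<and> snd (T b) \<subseteq> snd S) \<and>
     (\<forall>x\<in>fst (T False). \<forall>y\<in>fst (T True). (x, y) \<in> slope_pairs e (snd S))" for m S
    using scheme_node_split by blast
  then obtain step where step: "\<And>m S. scheme_node X e m S \<Longrightarrow>
     (\<forall>b. scheme_node X e (Suc m) (step m S b) \<and> closure (fst (step m S b)) \<subseteq> fst S \<and> snd (step m S b) \<subseteq> snd S) \<and>
     (\<forall>x\<in>fst (step m S False). \<forall>y\<in>fst (step m S True). (x, y) \<in> slope_pairs e (snd S))"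
    by metis
  define U where "U \<beta> m = fst (branch step S0 \<beta> m)" for \<beta> m
  define A where "A \<beta> m = snd (branch step S0 \<beta> m)" for \<beta> m
  have node: "scheme_node X e m (branch step S0 \<beta> m)" for \<beta> m
    by (induction m) (use S0 step in auto)
  have U_open: "open (U \<beta> m)" and U_ne: "U \<beta> m \<inter> X \<noteq> {}" and
    U_dist: "\<forall>x\<in>U \<beta> m. \<forall>y\<in>U \<beta> m. dist x y \<le> (1/2)^m" and A_ne: "A \<beta> m \<noteq> {}" and
    A_dist: "\<forall>x\<in>A \<beta> m. \<forall>y\<in>A \<beta> m. dist x y \<le> (1/2)^m" for \<beta> m
    using scheme_nodeD[OF node[of m \<beta>]] by (simp_all add: U_def A_def)
  have U_Suc: "closure (U \<beta> (Suc m)) \<subseteq> U \<beta> m" and A_Suc: "A \<beta> (Suc m) \<subseteq> A \<beta> m" for \<beta> m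
    using step[OF node[of m \<beta>]] by (simp_all add: U_def A_def)
  have U_mono: "U \<beta> n \<subseteq> U \<beta> m" if "m \<le> n" for \<beta> m n
    by (rule lift_Suc_antimono_le[OF _ that]) (rule order_trans[OF closure_subset U_Suc])
  have A_mono: "A \<beta> n \<subseteq> A \<beta> m" if "m \<le> n" for \<beta> m n
    by (rule lift_Suc_antimono_le[OF _ that]) (rule A_Suc)
  have U_cong: "U \<beta> m = U \<gamma> m" if "\<And>i. i < m \<Longrightarrow> \<beta> i = \<gamma> i" for \<beta> \<gamma> m
    unfolding U_def by (subst branch_cong[OF that]) auto
  \<comment> \<open>Two branches that part at level \<open>k\<close> have all their slopes in the set of the common node.\<close>
  have sep: "(x, y) \<in> slope_pairs e (A \<beta> k)"
    if "\<And>i. i < k \<Longrightarrow> \<beta> i = \<gamma> i" "\<beta> k \<noteq> \<gamma> k" "x \<in> U \<beta> (Suc k)" "y \<in> U \<gamma> (Suc k)" for \<beta> \<gamma> k x y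
  proof -
    have eq: "branch step S0 \<gamma> k = branch step S0 \<beta> k"
      using branch_cong[of k \<beta> \<gamma> step S0] that(1) by simp
    have x: "x \<in> fst (step k (branch step S0 \<beta> k) (\<beta> k))"
      using that(3) by (simp add: U_def)
    have y: "y \<in> fst (step k (branch step S0 \<beta> k) (\<gamma> k))"
      using that(4) by (simp add: U_def eq)
    have *: "\<forall>x\<in>fst (step k (branch step S0 \<beta> k) False). \<forall>y\<in>fst (step k (branch step S0 \<beta> k) True).
       (x, y) \<in> slope_pairs e (A \<beta> k)"
      using step[OF node[of k \<beta>]] by (simp add: A_def)
    show ?thesis
    proof (cases "\<beta> k")
      case True
      then have "(y, x) \<in> slope_pairs e (A \<beta> k)" using * x y that(2) by simp
      then show ?thesis by (simp add: slope_pairs_commute)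
    next
      case False
      then show ?thesis using * x y that(2) by simp
    qed
  qed
  have "\<exists>x. \<forall>m. x \<in> closure (U \<beta> m \<inter> X)" for \<beta>
  proof -
    have "bounded (closure (U \<beta> 0 \<inter> X))"
      by (intro bounded_closure bounded_Int disjI1 bounded_if_dist_le[OF U_dist])
    moreover have "closure (U \<beta> n \<inter> X) \<subseteq> closure (U \<beta> m \<inter> X)" if "m \<le> n" for m n
      using U_mono[OF that] by (intro closure_mono) blast
    moreover have "closure (U \<beta> m \<inter> X) \<noteq> {}" for m
      using U_ne by simp
    ultimately obtain x where "\<And>m. x \<in> closure (U \<beta> m \<inter> X)"
      using bounded_closed_nest[of "\<lambda>m. closure (U \<beta> m \<inter> X)"] closed_closure by metis
    then show ?thesis by blast
  qed
  then obtain c where c: "\<And>\<beta> m. c \<beta> \<in> closure (U \<beta> m \<inter> X)" by metis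
  have c_X: "c \<beta> \<in> X" for \<beta>
  proof -
    have "closure (U \<beta> 0 \<inter> X) \<subseteq> X"
      using assms(1) by (intro closure_minimal) auto
    then show ?thesis using c by blast
  qed
  have c_U: "c \<beta> \<in> U \<beta> m" for \<beta> m
  proof -
    have "closure (U \<beta> (Suc m) \<inter> X) \<subseteq> closure (U \<beta> (Suc m))"
      by (intro closure_mono) blast
    then show ?thesis using c[of \<beta> "Suc m"] U_Suc[of \<beta> m] by blast
  qed
  have "\<exists>a. \<forall>m. a \<in> closure (A \<beta> m)" for \<beta>
  proof -
    have "bounded (closure (A \<beta> 0))"
      by (intro bounded_closure bounded_if_dist_le[OF A_dist])
    moreover have "closure (A \<beta> n) \<subseteq> closure (A \<beta> m)" if "m \<le> n" for m n
      by (intro closure_mono A_mono that)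
    moreover have "closure (A \<beta> m) \<noteq> {}" for m
      using A_ne by simp
    ultimately obtain a where "\<And>m. a \<in> closure (A \<beta> m)"
      using bounded_closed_nest[of "\<lambda>m. closure (A \<beta> m)"] closed_closure by metis
    then show ?thesis by blast
  qed
  then obtain d where d: "\<And>\<beta> m. d \<beta> \<in> closure (A \<beta> m)" by metis
  have first: "\<exists>k. (\<forall>i<k. \<beta> i = \<gamma> i) \<and> \<beta> k \<noteq> \<gamma> k" if "\<beta> \<noteq> \<gamma>" for \<beta> \<gamma> :: "nat \<Rightarrow> bool"
  proof -
    have "\<exists>k. \<beta> k \<noteq> \<gamma> k" using that by blast
    from LeastI_ex[OF this] not_less_Least[of _ "\<lambda>k. \<beta> k \<noteq> \<gamma> k"] show ?thesis by blast
  qed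
  have inj: "inj (\<lambda>\<beta>. c \<beta> \<bullet> e)"
  proof (rule injI, rule ccontr)
    fix \<beta> \<gamma> assume eq: "c \<beta> \<bullet> e = c \<gamma> \<bullet> e" and "\<beta> \<noteq> \<gamma>"
    then obtain k where k: "\<forall>i<k. \<beta> i = \<gamma> i" "\<beta> k \<noteq> \<gamma> k" using first by blast
    then have "(c \<beta>, c \<gamma>) \<in> slope_pairs e (A \<beta> k)"
      using sep[of k \<beta> \<gamma>, OF _ _ c_U c_U] by blast
    with eq show False by (simp add: slope_pairs_def inner_diff_left)
  qed
  have small: "\<exists>m. (1/2)^m < \<epsilon>" if "0 < \<epsilon>" for \<epsilon> :: real
    using real_arch_pow_inv[OF that, of "1/2"] by auto
  have "continuous_on UNIV c"
    unfolding continuous_on_topological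
  proof (intro ballI allI impI)
    fix \<beta> B assume "open B" "c \<beta> \<in> B"
    then obtain \<epsilon> where \<epsilon>: "0 < \<epsilon>" "ball (c \<beta>) \<epsilon> \<subseteq> B" using open_contains_ball by blast
    obtain m where m: "(1/2)^m < \<epsilon>" using small[OF \<epsilon>(1)] by blast
    have "c \<gamma> \<in> B" if "\<forall>i<m. \<gamma> i = \<beta> i" for \<gamma>
    proof -
      have "c \<gamma> \<in> U \<beta> m" using c_U[of \<gamma> m] U_cong[of m \<gamma> \<beta>] that by auto
      then have "dist (c \<beta>) (c \<gamma>) < \<epsilon>" using U_dist c_U[of \<beta> m] m by fastforce
      then show ?thesis using \<epsilon>(2) by auto
    qed
    then show "\<exists>A. open A \<and> \<beta> \<in> A \<and> (\<forall>y\<in>UNIV. y \<in> A \<longrightarrow> c y \<in> B)"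
      by (intro exI[of _ "{\<gamma>. \<forall>i<m. \<gamma> i = \<beta> i}"]) (auto simp: open_cylinder)
  qed
  moreover have "\<exists>\<delta>>0. \<forall>\<beta> \<gamma>. dist (c \<beta>) (c \<gamma>) < \<delta> \<longrightarrow>
       norm (c \<gamma> - c \<beta> - ((c \<gamma> - c \<beta>) \<bullet> e) *\<^sub>R d \<beta>) \<le> \<epsilon> * \<bar>(c \<gamma> - c \<beta>) \<bullet> e\<bar>" if \<epsilon>: "0 < \<epsilon>" for \<epsilon>
  proof -
    obtain m where m: "(1/2)^m < \<epsilon>" using small[OF \<epsilon>] by blast
    have "compact (range c)"
      using \<open>continuous_on UNIV c\<close> compact_Cantor_space compact_continuous_image by blast
    moreover have "range c \<subseteq> \<Union> (range (\<lambda>\<beta>. U \<beta> m))" using c_U by blast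
    ultimately obtain \<delta> where \<delta>: "0 < \<delta>" "\<And>x. x \<in> range c \<Longrightarrow> \<exists>G\<in>range (\<lambda>\<beta>. U \<beta> m). ball x \<delta> \<subseteq> G"
      using Heine_Borel_lemma[of "range c" "range (\<lambda>\<beta>. U \<beta> m)"] U_open by blast
    \<comment> \<open>If the branches parted above level \<open>m\<close>, then by \<open>sep\<close> the point \<open>c \<beta>\<close> would have a slope to itself.\<close>
    have agree: "\<forall>i<m. \<beta> i = \<gamma> i" if "c \<beta> \<in> U \<gamma> m" for \<beta> \<gamma>
    proof (rule ccontr)
      assume "\<not> ?thesis"
      then have "\<beta> \<noteq> \<gamma>" by auto
      then obtain k where k: "\<forall>i<k. \<beta> i = \<gamma> i" "\<beta> k \<noteq> \<gamma> k" using first by blast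
      with \<open>\<not> ?thesis\<close> have "k < m" by (meson not_less order_less_le_trans)
      then have "c \<beta> \<in> U \<gamma> (Suc k)" using that U_mono[of "Suc k" m \<gamma>] by auto
      then have "(c \<beta>, c \<beta>) \<in> slope_pairs e (A \<beta> k)" using sep[of k \<beta> \<gamma>, OF _ _ c_U] k c_U by blast
      then show False by (simp add: slope_pairs_def)
    qed
    have "norm (c \<gamma> - c \<beta> - ((c \<gamma> - c \<beta>) \<bullet> e) *\<^sub>R d \<beta>) \<le> \<epsilon> * \<bar>(c \<gamma> - c \<beta>) \<bullet> e\<bar>"
      if "dist (c \<beta>) (c \<gamma>) < \<delta>" for \<beta> \<gamma>
    proof (cases "\<beta> = \<gamma>")
      case False
      then obtain k where k: "\<forall>i<k. \<beta> i = \<gamma> i" "\<beta> k \<noteq> \<gamma> k" using first by blast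
      obtain \<eta> where "ball (c \<beta>) \<delta> \<subseteq> U \<eta> m" using \<delta>(2) by blast
      then have "c \<beta> \<in> U \<eta> m" "c \<gamma> \<in> U \<eta> m" using that \<delta>(1) by auto
      then have "\<forall>i<m. \<beta> i = \<gamma> i" using agree by metis
      then have "m \<le> k" using k(2) not_less by blast
      define l where "l = (c \<gamma> - c \<beta>) \<bullet> e"
      have "(c \<beta>, c \<gamma>) \<in> slope_pairs e (A \<beta> k)"
        using sep[of k \<beta> \<gamma>, OF _ _ c_U] k c_U by blast
      then have "(c \<gamma>, c \<beta>) \<in> slope_pairs e (A \<beta> k)" by (simp add: slope_pairs_commute)
      then have l: "l \<noteq> 0" "slope e (c \<gamma>) (c \<beta>) \<in> A \<beta> k" by (auto simp: slope_pairs_def l_def)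
      have "dist (slope e (c \<gamma>) (c \<beta>)) (d \<beta>) \<le> (1/2)^k"
        using closure_dist_le[OF A_dist l(2) d] .
      also have "\<dots> \<le> (1/2)^m" using \<open>m \<le> k\<close> by (intro power_decreasing) auto
      finally have le: "norm (slope e (c \<gamma>) (c \<beta>) - d \<beta>) \<le> \<epsilon>" using m by (simp add: dist_norm)
      have "c \<gamma> - c \<beta> - l *\<^sub>R d \<beta> = l *\<^sub>R (slope e (c \<gamma>) (c \<beta>) - d \<beta>)"
        using l(1) by (simp add: slope_def scaleR_diff_right flip: l_def)
      then have "norm (c \<gamma> - c \<beta> - l *\<^sub>R d \<beta>) = \<bar>l\<bar> * norm (slope e (c \<gamma>) (c \<beta>) - d \<beta>)" by simp
      also have "\<dots> \<le> \<bar>l\<bar> * \<epsilon>" using le by (intro mult_left_mono) auto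
      finally show ?thesis by (simp add: l_def mult.commute)
    qed auto
    with \<delta>(1) show ?thesis by blast
  qed
  ultimately show thesis using that[of e c d] e c_X inj by blast
qed

section \<open>Uncountable sets and condensation points\<close>

lemma uncountable_Cantor_space: "uncountable (UNIV :: (nat \<Rightarrow> bool) set)"
proof
  assume c: "countable (UNIV :: (nat \<Rightarrow> bool) set)"
  define f where "f = from_nat_into (UNIV :: (nat \<Rightarrow> bool) set)"
  have "range f = UNIV" using c by (simp add: f_def range_from_nat_into)
  then obtain n where "f n = (\<lambda>i. \<not> f i i)" by (metis surjD)
  then show False by (metis (full_types))
qed

lemma uncountable_Cantor_set:
  fixes Q :: "'a::topological_space set"
  assumes "is_Cantor_set Q"
  shows "uncountable Q"
proof
  assume "countable Q"
  obtain f g where "homeomorphism Q (UNIV :: (nat \<Rightarrow> bool) set) f g"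
    using assms unfolding is_Cantor_set_def homeomorphic_def by blast
  then have "f ` Q = UNIV" by (simp add: homeomorphism_def)
  with \<open>countable Q\<close> have "countable (UNIV :: (nat \<Rightarrow> bool) set)" by (metis countable_image)
  then show False using uncountable_Cantor_space by blast
qed

text \<open>As in the Cantor--Bendixson theorem, remove all open sets that meet \<open>P\<close> in a countable set. By
  the Lindelof property only countably many points are lost, so every neighbourhood of a remaining point still
  contains uncountably many remaining points.\<close>

lemma condensation_points:
  fixes P :: "'a::euclidean_space set"
  assumes "closed P" "uncountable P"
  obtains X where "X \<subseteq> P" "closed X" "X \<noteq> {}" "\<And>x. x \<in> X \<Longrightarrow> x islimpt X"
proof -
  define \<F> where "\<F> = {U. open U \<and> countable (U \<inter> P)}"
  obtain \<G> where G: "\<G> \<subseteq> \<F>" "countable \<G>" "\<Union>\<G> = \<Union>\<F>"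
    using Lindelof[of \<F>] by (auto simp: \<F>_def)
  have "countable (\<Union>U\<in>\<G>. U \<inter> P)"
    using G by (intro countable_UN) (auto simp: \<F>_def)
  then have cnt: "countable (\<Union>\<F> \<inter> P)" using G(3) by (metis Int_commute Int_Union SUP_cong)
  have op: "open (\<Union>\<F>)" by (auto simp: \<F>_def)
  show thesis
  proof (rule that[of "P - \<Union>\<F>"])
    show "closed (P - \<Union>\<F>)" using assms(1) op by (rule closed_Diff)
    have "uncountable (P - \<Union>\<F>)"
      using cnt assms(2) by (metis Int_Diff_Un Int_commute countable_Un)
    then show "P - \<Union>\<F> \<noteq> {}" by (metis countable_empty)
    show "x islimpt P - \<Union>\<F>" if x: "x \<in> P - \<Union>\<F>" for x
    proof (rule islimptI)
      fix T assume T: "x \<in> T" "open T"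
      have "uncountable (T \<inter> P)" using x T by (auto simp: \<F>_def)
      moreover have "T \<inter> P \<subseteq> (\<Union>\<F> \<inter> P) \<union> (T \<inter> (P - \<Union>\<F>) - {x}) \<union> {x}" by auto
      ultimately have "T \<inter> (P - \<Union>\<F>) - {x} \<noteq> {}"
        using cnt by (metis countable_Un countable_empty countable_insert countable_subset)
      then show "\<exists>y\<in>P - \<Union>\<F>. y \<in> T \<and> y \<noteq> x" by blast
    qed
  qed auto
qed

section \<open>Whitney extension in one variable\<close>

text \<open>The cubic that increases from \<open>0\<close> to \<open>1\<close> on the unit interval with vanishing derivative at both
  ends.\<close>

definition smoothstep :: "real \<Rightarrow> real" where
  "smoothstep u = 3 * u^2 - 2 * u^3"

lemma smoothstep_0 [simp]: "smoothstep 0 = 0"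
  by (simp add: smoothstep_def)

lemma smoothstep_flip: "smoothstep (1 - u) = 1 - smoothstep u"
  by (simp add: smoothstep_def power2_eq_square power3_eq_cube algebra_simps)

lemma smoothstep_bound:
  assumes "0 \<le> u" "u \<le> 1"
  shows "\<bar>smoothstep u\<bar> \<le> 3 * u * u"
proof -
  have eq: "smoothstep u = u * u * (3 - 2 * u)"
    by (simp add: smoothstep_def power2_eq_square power3_eq_cube algebra_simps)
  have "u * u * (3 - 2 * u) \<le> u * u * 3" "0 \<le> u * u * (3 - 2 * u)"
    using assms by (auto intro!: mult_left_mono)
  then show ?thesis by (simp add: eq)
qed

definition gap_curve :: "(real \<Rightarrow> 'a::real_normed_vector) \<Rightarrow> real \<Rightarrow> real \<Rightarrow> real \<Rightarrow> 'a" where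
  "gap_curve f x y t = f x + smoothstep ((t - x) / (y - x)) *\<^sub>R (f y - f x)"

definition gap_velocity :: "(real \<Rightarrow> 'a::real_normed_vector) \<Rightarrow> real \<Rightarrow> real \<Rightarrow> real \<Rightarrow> 'a" where
  "gap_velocity f x y t = (6 * ((t - x) / (y - x)) * (1 - (t - x) / (y - x)) / (y - x)) *\<^sub>R (f y - f x)"

lemma gap_curve_derivative:
  "(gap_curve f x y has_vector_derivative gap_velocity f x y t) (at t)"
proof (cases "x = y")
  case True
  then show ?thesis
    unfolding gap_curve_def gap_velocity_def by (auto intro!: derivative_eq_intros)
next
  case False
  have "(smoothstep has_field_derivative 6 * u * (1 - u)) (at u)" for u
    unfolding smoothstep_def
    by (auto intro!: derivative_eq_intros simp: algebra_simps power2_eq_square)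
  moreover have "((\<lambda>t. (t - x) / (y - x)) has_field_derivative 1 / (y - x)) (at t)"
    using False by (auto intro!: derivative_eq_intros)
  ultimately have "((\<lambda>t. smoothstep ((t - x) / (y - x))) has_field_derivative
      6 * ((t - x) / (y - x)) * (1 - (t - x) / (y - x)) * (1 / (y - x))) (at t)"
    by (rule DERIV_chain2)
  then have "((\<lambda>t. smoothstep ((t - x) / (y - x))) has_field_derivative
      6 * ((t - x) / (y - x)) * (1 - (t - x) / (y - x)) / (y - x)) (at t)"
    by simp
  then show ?thesis
    unfolding gap_curve_def gap_velocity_def by (auto intro!: derivative_eq_intros)
qed

text \<open>The velocity on a gap is the mean slope of \<open>f\<close> over the gap times \<open>6 u (1 - u)\<close>. Short gaps
  have a small mean slope by hypothesis. On long gaps the mean slope is merely bounded, but there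
  \<open>u (1 - u)\<close> is small near the ends. The threshold \<open>\<delta>1\<close> separates the two cases, and \<open>p\<close> is the end
  of the gap that is close to \<open>t\<close>.\<close>

lemma gap_estimate:
  fixes f :: "real \<Rightarrow> 'a::real_normed_vector"
  assumes K: "compact K" and "0 < \<epsilon>"
    and f: "\<And>\<epsilon>. 0 < \<epsilon> \<Longrightarrow> \<exists>\<delta>>0. \<forall>s\<in>K. \<forall>t\<in>K. \<bar>s - t\<bar> < \<delta> \<longrightarrow> norm (f s - f t) \<le> \<epsilon> * \<bar>s - t\<bar>"
  obtains \<delta> where "0 < \<delta>"
    "\<And>x y p t. \<lbrakk>x \<in> K; y \<in> K; x \<le> t; t \<le> y; x < y; p \<in> {x, y}; \<bar>t - p\<bar> < \<delta>\<rbrakk> \<Longrightarrow>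
       norm (gap_velocity f x y t) \<le> \<epsilon> \<and> norm (gap_curve f x y t - f p) \<le> \<epsilon> * \<bar>t - p\<bar>"
proof -
  obtain \<delta>1 where \<delta>1: "0 < \<delta>1" "\<And>s t. s \<in> K \<Longrightarrow> t \<in> K \<Longrightarrow> \<bar>s - t\<bar> < \<delta>1 \<Longrightarrow> norm (f s - f t) \<le> \<epsilon>/6 * \<bar>s - t\<bar>"
    using f[of "\<epsilon>/6"] \<open>0 < \<epsilon>\<close> by auto
  have "continuous_on K f"
    unfolding continuous_on_iff
  proof (intro ballI allI impI)
    fix x and e :: real assume "x \<in> K" "0 < e"
    have "dist (f y) (f x) < e" if "y \<in> K" "dist y x < min \<delta>1 (e * 6/\<epsilon>)" for y
    proof -
      have "\<bar>y - x\<bar> < \<delta>1" "\<bar>y - x\<bar> < e * 6/\<epsilon>" using that(2) by (auto simp: dist_real_def)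
      moreover have "\<epsilon>/6 * \<bar>y - x\<bar> < e" using \<open>\<bar>y - x\<bar> < e * 6/\<epsilon>\<close> \<open>0 < \<epsilon>\<close> by (simp add: field_simps)
      ultimately show ?thesis using \<delta>1(2)[OF \<open>y \<in> K\<close> \<open>x \<in> K\<close>] by (simp add: dist_norm)
    qed
    then show "\<exists>d>0. \<forall>y\<in>K. dist y x < d \<longrightarrow> dist (f y) (f x) < e"
      using \<delta>1(1) \<open>0 < e\<close> \<open>0 < \<epsilon>\<close> by (intro exI[of _ "min \<delta>1 (e * 6/\<epsilon>)"]) auto
  qed
  then have "bounded (f ` K)" using K by (intro compact_imp_bounded compact_continuous_image)
  then obtain B where B: "0 < B" "\<And>x. x \<in> K \<Longrightarrow> norm (f x) \<le> B"
    unfolding bounded_pos by blast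
  \<comment> \<open>Chosen so that \<open>6 w D / (y - x) \<le> \<epsilon>\<close> when \<open>w \<le> \<delta> / \<delta>1\<close>, \<open>D \<le> 2 B\<close> and \<open>y - x \<ge> \<delta>1\<close>.\<close>
  define \<delta> where "\<delta> = \<epsilon> * \<delta>1\<^sup>2 / (12 * B)"
  have \<delta>: "0 < \<delta>" using \<delta>1(1) B(1) \<open>0 < \<epsilon>\<close> by (simp add: \<delta>_def)
  have "norm (gap_velocity f x y t) \<le> \<epsilon> \<and> norm (gap_curve f x y t - f p) \<le> \<epsilon> * \<bar>t - p\<bar>"
    if xy: "x \<in> K" "y \<in> K" "x \<le> t" "t \<le> y" "x < y" "p \<in> {x, y}" "\<bar>t - p\<bar> < \<delta>" for x y p t
  proof -
    define u where "u = (t - x) / (y - x)"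
    \<comment> \<open>The relative distance from \<open>p\<close>; by symmetry of the smoothstep both ends are treated at once.\<close>
    define w where "w = \<bar>t - p\<bar> / (y - x)"
    define D where "D = norm (f y - f x)"
    have u: "0 \<le> u" "u \<le> 1" using xy by (auto simp: u_def)
    have w: "w = (if p = x then u else 1 - u)"
      using xy by (auto simp: w_def u_def field_simps)
    have w01: "0 \<le> w" "w \<le> 1" using u by (auto simp: w)
    have D0: "0 \<le> D" by (simp add: D_def)
    have main: "6 * w * D / (y - x) \<le> \<epsilon>"
    proof (cases "y - x < \<delta>1")
      case True
      then have "D \<le> \<epsilon>/6 * (y - x)" using \<delta>1(2)[OF xy(2,1)] xy(5) by (simp add: D_def)
      then have "w * D \<le> 1 * (\<epsilon>/6 * (y - x))"
        using w01 D0 by (intro mult_mono) auto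
      then show ?thesis using xy(5) by (simp add: field_simps)
    next
      case False
      have "D \<le> 2 * B"
        using B(2)[OF xy(1)] B(2)[OF xy(2)] norm_triangle_ineq4[of "f y" "f x"] by (simp add: D_def)
      moreover have "w \<le> \<delta> / \<delta>1"
        unfolding w_def using xy(5,7) False \<delta>1(1) by (intro frac_le) auto
      ultimately have "w * D \<le> \<delta> / \<delta>1 * (2 * B)"
        using D0 \<delta> \<delta>1(1) by (intro mult_mono) auto
      then have "6 * w * D / (y - x) \<le> 6 * (\<delta> / \<delta>1 * (2 * B)) / \<delta>1"
        using False \<delta>1(1) \<delta> B(1) by (intro frac_le) auto
      also have "\<dots> = \<epsilon>" using \<delta>1(1) B(1) by (simp add: \<delta>_def field_simps power2_eq_square)
      finally show ?thesis .
    qed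
    have "u * (1 - u) \<le> w"
      using u by (auto simp: w mult_left_le mult_left_le_one_le)
    then have "6 * u * (1 - u) * D / (y - x) \<le> 6 * w * D / (y - x)"
      using D0 xy(5) by (intro divide_right_mono mult_right_mono) auto
    moreover have "norm (gap_velocity f x y t) = 6 * u * (1 - u) * D / (y - x)"
      using u xy(5) by (simp add: gap_velocity_def D_def flip: u_def)
    ultimately have 1: "norm (gap_velocity f x y t) \<le> \<epsilon>" using main by linarith
    have "norm (gap_curve f x y t - f p) = \<bar>smoothstep w\<bar> * D"
    proof (cases "p = x")
      case True
      then show ?thesis by (simp add: w gap_curve_def D_def flip: u_def)
    next
      case False
      then have "gap_curve f x y t - f p = - ((1 - smoothstep u) *\<^sub>R (f y - f x))"
        using xy(6) by (simp add: gap_curve_def algebra_simps flip: u_def)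
      also have "norm \<dots> = \<bar>smoothstep w\<bar> * D"
        using False by (simp add: w smoothstep_flip D_def)
      finally show ?thesis .
    qed
    also have "\<dots> \<le> 3 * w * w * D"
      using smoothstep_bound[OF w01] D0 by (intro mult_right_mono)
    also have "\<dots> = 1/2 * (6 * w * D / (y - x)) * \<bar>t - p\<bar>"
      using xy(5) by (simp add: w_def)
    also have "\<dots> \<le> 1/2 * \<epsilon> * \<bar>t - p\<bar>"
      using main by (intro mult_right_mono mult_left_mono) auto
    also have "\<dots> \<le> \<epsilon> * \<bar>t - p\<bar>"
      using \<open>0 < \<epsilon>\<close> by (intro mult_right_mono) auto
    finally show ?thesis using 1 by blast
  qed
  with \<delta> show thesis using that by blast
qed

text \<open>The functions \<open>l\<close> and \<open>r\<close> give the nearest points of \<open>K\<close> to the left and to the right.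
  Maximality of \<open>l t\<close> and minimality of \<open>r t\<close> are expressed by the arbitrary bounds \<open>s\<close> and \<open>s'\<close>.\<close>

lemma neighbours_in_compact:
  fixes K :: "real set"
  assumes "compact K"
  obtains l r where
    "\<And>t s s'. \<lbrakk>s \<in> K; s' \<in> K; s \<le> t; t \<le> s'\<rbrakk> \<Longrightarrow>
        l t \<in> K \<and> r t \<in> K \<and> s \<le> l t \<and> l t \<le> t \<and> t \<le> r t \<and> r t \<le> s'"
proof
  fix t s s' assume *: "s \<in> K" "s' \<in> K" "s \<le> t" "t \<le> s'"
  have c: "compact (K \<inter> {..t})" "compact (K \<inter> {t..})"
    using assms by (auto intro: compact_Int_closed)
  have "Sup (K \<inter> {..t}) \<in> K \<inter> {..t}"
    using * c(1) by (intro closed_contains_Sup) (auto simp: compact_imp_closed)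
  moreover have "Inf (K \<inter> {t..}) \<in> K \<inter> {t..}"
    using * c(2) by (intro closed_contains_Inf) (auto simp: compact_imp_closed)
  moreover have "s \<le> Sup (K \<inter> {..t})" and "Inf (K \<inter> {t..}) \<le> s'"
    using * by (auto intro!: cSup_upper cInf_lower)
  ultimately show "Sup (K \<inter> {..t}) \<in> K \<and> Inf (K \<inter> {t..}) \<in> K \<and> s \<le> Sup (K \<inter> {..t})
     \<and> Sup (K \<inter> {..t}) \<le> t \<and> t \<le> Inf (K \<inter> {t..}) \<and> Inf (K \<inter> {t..}) \<le> s'"
    by auto
qed

text \<open>Each gap of \<open>K\<close> is bridged by a rescaled smoothstep. Near a point \<open>s\<close> of \<open>K\<close> the increment from
  \<open>s\<close> to \<open>t\<close> splits at the endpoint \<open>p\<close> of the gap of \<open>t\<close> that faces \<open>s\<close>: the part from \<open>s\<close> to \<open>p\<close>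
  is controlled by the hypothesis on \<open>f\<close>, the part from \<open>p\<close> to \<open>t\<close> by \<open>gap_estimate\<close>.\<close>

lemma C1_extension_with_critical_set:
  fixes f :: "real \<Rightarrow> 'a::real_normed_vector"
  assumes K: "compact K" "a \<in> K" "b \<in> K"
    and f: "\<And>\<epsilon>. 0 < \<epsilon> \<Longrightarrow> \<exists>\<delta>>0. \<forall>s\<in>K. \<forall>t\<in>K. \<bar>s - t\<bar> < \<delta> \<longrightarrow> norm (f s - f t) \<le> \<epsilon> * \<bar>s - t\<bar>"
  obtains F H where "continuous_on {a..b} H"
    "\<And>t. t \<in> {a..b} \<Longrightarrow> (F has_vector_derivative H t) (at t within {a..b})"
    "\<And>t. t \<in> K \<Longrightarrow> F t = f t"
proof -
  obtain l r where lr: "\<And>t s s'. \<lbrakk>s \<in> K; s' \<in> K; s \<le> t; t \<le> s'\<rbrakk> \<Longrightarrow>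
        l t \<in> K \<and> r t \<in> K \<and> s \<le> l t \<and> l t \<le> t \<and> t \<le> r t \<and> r t \<le> s'"
    using neighbours_in_compact[OF K(1)] by blast
  define F where "F t = gap_curve f (l t) (r t) t" for t
  define H where "H t = gap_velocity f (l t) (r t) t" for t
  \<comment> \<open>On \<open>K\<close> the gap degenerates to a point and the divisions by zero give the values needed there.\<close>
  have on_K: "F s = f s" "H s = 0" if "s \<in> K" for s
  proof -
    have "l s = s" "r s = s" using lr[of s s s] that by auto
    then show "F s = f s" "H s = 0" by (simp_all add: F_def H_def gap_curve_def gap_velocity_def)
  qed
  have near: "\<exists>\<delta>>0. \<forall>t\<in>{a..b}. \<bar>t - s\<bar> < \<delta> \<longrightarrow> norm (H t) \<le> \<epsilon> \<and> norm (F t - f s) \<le> \<epsilon> * \<bar>t - s\<bar>"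
    if s: "s \<in> K" and \<epsilon>: "0 < \<epsilon>" for s \<epsilon>
  proof -
    obtain \<delta>1 where \<delta>1: "0 < \<delta>1" "\<And>s t. s \<in> K \<Longrightarrow> t \<in> K \<Longrightarrow> \<bar>s - t\<bar> < \<delta>1 \<Longrightarrow> norm (f s - f t) \<le> \<epsilon> * \<bar>s - t\<bar>"
      using f[OF \<epsilon>] by auto
    obtain \<delta>2 where \<delta>2: "0 < \<delta>2"
      "\<And>x y p t. \<lbrakk>x \<in> K; y \<in> K; x \<le> t; t \<le> y; x < y; p \<in> {x, y}; \<bar>t - p\<bar> < \<delta>2\<rbrakk> \<Longrightarrow>
       norm (gap_velocity f x y t) \<le> \<epsilon> \<and> norm (gap_curve f x y t - f p) \<le> \<epsilon> * \<bar>t - p\<bar>"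
      using gap_estimate[OF K(1) \<epsilon> f] by metis
    have "norm (H t) \<le> \<epsilon> \<and> norm (F t - f s) \<le> \<epsilon> * \<bar>t - s\<bar>"
      if t: "t \<in> {a..b}" "\<bar>t - s\<bar> < min \<delta>1 \<delta>2" for t
    proof (cases "t \<in> K")
      case True
      then show ?thesis using \<delta>1(2)[OF True s] t on_K[OF True] \<epsilon> by simp
    next
      case False
      define p where "p = (if s \<le> t then l t else r t)"
      have ab: "l t \<in> K" "r t \<in> K" "l t \<le> t" "t \<le> r t" using lr[OF K(2,3), of t] t by auto
      with False have less: "l t < r t" by (metis order_antisym not_le order_trans)
      have "s \<le> l t" if "s \<le> t" using lr[OF s K(3) that] t by auto
      moreover have "r t \<le> s" if "\<not> s \<le> t" using lr[OF K(2) s] that t by auto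
      ultimately have split: "\<bar>t - s\<bar> = \<bar>t - p\<bar> + \<bar>p - s\<bar>" and "p \<in> {l t, r t}" and "p \<in> K"
        using ab by (auto simp: p_def)
      then have "norm (H t) \<le> \<epsilon> \<and> norm (F t - f p) \<le> \<epsilon> * \<bar>t - p\<bar>"
        unfolding F_def H_def using t ab less by (intro \<delta>2(2)) auto
      moreover have "norm (f p - f s) \<le> \<epsilon> * \<bar>p - s\<bar>"
        using \<delta>1(2)[OF \<open>p \<in> K\<close> s] split t by auto
      moreover have "norm (F t - f s) \<le> norm (F t - f p) + norm (f p - f s)"
        using norm_triangle_ineq[of "F t - f p" "f p - f s"] by simp
      ultimately show ?thesis by (simp add: split distrib_left)
    qed
    then show ?thesis using \<delta>1(1) \<delta>2(1) by (intro exI[of _ "min \<delta>1 \<delta>2"]) auto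
  qed
  have gap: "t \<in> {l t<..<r t}" "\<And>t'. t' \<in> {l t<..<r t} \<Longrightarrow> F t' = gap_curve f (l t) (r t) t' \<and> H t' = gap_velocity f (l t) (r t) t'"
    if t: "t \<in> {a..b}" "t \<notin> K" for t
  proof -
    have ab: "l t \<in> K" "r t \<in> K" "l t \<le> t" "t \<le> r t" using lr[OF K(2,3), of t] t by auto
    then show 1: "t \<in> {l t<..<r t}" using t(2) by (auto simp: order_less_le)
    fix t' assume t': "t' \<in> {l t<..<r t}"
    have "l t' \<in> K \<and> r t' \<in> K \<and> l t \<le> l t' \<and> l t' \<le> t' \<and> t' \<le> r t' \<and> r t' \<le> r t"
      using lr[OF ab(1,2), of t'] t' by auto
    moreover have "s \<le> l t \<or> r t \<le> s" if "s \<in> K" for s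
      using lr[OF that K(3), of t] lr[OF K(2) that, of t] t by (cases "s \<le> t") auto
    ultimately have "l t' = l t" "r t' = r t" using t' by (metis order_antisym greaterThanLessThan_iff leD order_trans)+
    then show "F t' = gap_curve f (l t) (r t) t' \<and> H t' = gap_velocity f (l t) (r t) t'"
      by (simp add: F_def H_def)
  qed
  show thesis
  proof (rule that[of H F])
    show "continuous_on {a..b} H"
      unfolding continuous_on_eq_continuous_within
    proof
      fix t assume t: "t \<in> {a..b}"
      show "continuous (at t within {a..b}) H"
      proof (cases "t \<in> K")
        case True
        show ?thesis
          unfolding continuous_within_eps_delta
        proof (intro allI impI)
          fix e :: real assume "0 < e"
          then obtain \<delta> where "0 < \<delta>" "\<forall>t'\<in>{a..b}. \<bar>t' - t\<bar> < \<delta> \<longrightarrow> norm (H t') \<le> e/2"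
            using near[OF True, of "e/2"] by auto
          then show "\<exists>d>0. \<forall>x'\<in>{a..b}. dist x' t < d \<longrightarrow> dist (H x') (H t) < e"
            using \<open>0 < e\<close> by (intro exI[of _ \<delta>]) (force simp: on_K[OF True] dist_real_def)
        qed
      next
        case False
        have "continuous_on {l t<..<r t} (gap_velocity f (l t) (r t))"
          unfolding gap_velocity_def using gap(1)[OF t False] by (intro continuous_intros) auto
        then have "continuous_on {l t<..<r t} H"
          by (rule continuous_on_eq) (rule conjunct2[OF gap(2)[OF t False], symmetric])
        then have "isCont H t"
          using gap(1)[OF t False] continuous_on_eq_continuous_at[OF open_greaterThanLessThan] by blast
        then show ?thesis by (rule continuous_at_imp_continuous_at_within)
      qed
    qed
    show "(F has_vector_derivative H t) (at t within {a..b})" if t: "t \<in> {a..b}" for t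
    proof (cases "t \<in> K")
      case True
      have "\<exists>d>0. \<forall>y\<in>{a..b}. norm (y - t) < d \<longrightarrow> norm (F y - F t - 0) \<le> e * norm (y - t)" if "0 < e" for e
        using near[OF True that] on_K[OF True] by auto
      then show ?thesis
        unfolding has_vector_derivative_def has_derivative_within_alt
        by (simp add: on_K[OF True])
    next
      case False
      have "(F has_vector_derivative H t) (at t)"
      proof (rule has_vector_derivative_transform_within_open)
        show "(gap_curve f (l t) (r t) has_vector_derivative H t) (at t)"
          unfolding H_def by (rule gap_curve_derivative)
        show "t \<in> {l t<..<r t}" "open {l t<..<r t}" using gap(1)[OF t False] by auto
        show "gap_curve f (l t) (r t) y = F y" if "y \<in> {l t<..<r t}" for y
          using gap(2)[OF t False that] by simp
      qed
      then show ?thesis by (rule has_vector_derivative_at_within)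
    qed
  qed (use on_K in auto)
qed

lemma C1_uniformly_differentiable:
  fixes g :: "real \<Rightarrow> 'a::real_normed_vector"
  assumes "\<And>t. t \<in> {a..b} \<Longrightarrow> (g has_vector_derivative g' t) (at t within {a..b})"
    and g': "continuous_on {a..b} g'" and "0 < \<epsilon>"
  shows "\<exists>\<delta>>0. \<forall>s\<in>{a..b}. \<forall>t\<in>{a..b}. \<bar>s - t\<bar> < \<delta> \<longrightarrow>
    norm (g s - g t - (s - t) *\<^sub>R g' t) \<le> \<epsilon> * \<bar>s - t\<bar>"
proof -
  have "uniformly_continuous_on {a..b} g'"
    using g' by (rule compact_uniformly_continuous) simp
  then obtain \<delta> where \<delta>: "0 < \<delta>" "\<And>s t. s \<in> {a..b} \<Longrightarrow> t \<in> {a..b} \<Longrightarrow> dist t s < \<delta> \<Longrightarrow> dist (g' t) (g' s) < \<epsilon>"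
    using \<open>0 < \<epsilon>\<close> unfolding uniformly_continuous_on_def by metis
  have "norm (g s - g t - (s - t) *\<^sub>R g' t) \<le> norm (s - t) * \<epsilon>"
    if st: "s \<in> {a..b}" "t \<in> {a..b}" "\<bar>s - t\<bar> < \<delta>" for s t
  proof (rule vector_differentiable_bound_linearization)
    let ?S = "closed_segment t s"
    have sub: "?S \<subseteq> {a..b}" using st by (auto simp: closed_segment_eq_real_ivl split: if_splits)
    show "(g has_vector_derivative g' x) (at x within ?S)" if "x \<in> ?S" for x
      using assms(1) sub that has_vector_derivative_within_subset by blast
    show "norm (g' x - g' t) \<le> \<epsilon>" if "x \<in> ?S" for x
    proof -
      have "dist x t < \<delta>"
        using that st(3) by (auto simp: closed_segment_eq_real_ivl dist_real_def split: if_splits)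
      then show ?thesis using \<delta>(2)[of t x] st(2) sub that by (force simp: dist_norm)
    qed
  qed auto
  then show ?thesis using \<delta>(1) by (auto simp: mult.commute)
qed

text \<open>Subtracting an antiderivative \<open>G\<close> of a continuous extension of \<open>d\<close> reduces the problem to
  derivative zero on \<open>K\<close>. Continuity of \<open>d\<close> follows from the hypothesis by exchanging \<open>s\<close> and
  \<open>t\<close>.\<close>

lemma Whitney_extension_C1:
  fixes f :: "real \<Rightarrow> 'a::euclidean_space"
  assumes K: "compact K" "a \<in> K" "b \<in> K" "K \<subseteq> {a..b}"
    and f: "\<And>\<epsilon>. 0 < \<epsilon> \<Longrightarrow> \<exists>\<delta>>0. \<forall>s\<in>K. \<forall>t\<in>K. \<bar>s - t\<bar> < \<delta> \<longrightarrow>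
      norm (f s - f t - (s - t) *\<^sub>R d t) \<le> \<epsilon> * \<bar>s - t\<bar>"
  obtains g g' where "continuous_on {a..b} g'"
    "\<And>t. t \<in> {a..b} \<Longrightarrow> (g has_vector_derivative g' t) (at t within {a..b})"
    "\<And>t. t \<in> K \<Longrightarrow> g t = f t"
proof -
  have "continuous_on K d"
    unfolding continuous_on_iff
  proof (intro ballI allI impI)
    fix t e :: real assume t: "t \<in> K" and "0 < e"
    obtain \<delta> where \<delta>: "0 < \<delta>" "\<And>s t. s \<in> K \<Longrightarrow> t \<in> K \<Longrightarrow> \<bar>s - t\<bar> < \<delta> \<Longrightarrow>
      norm (f s - f t - (s - t) *\<^sub>R d t) \<le> e/3 * \<bar>s - t\<bar>"
      using f[of "e/3"] \<open>0 < e\<close> by auto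
    have "dist (d s) (d t) < e" if s: "s \<in> K" "dist s t < \<delta>" for s
    proof (cases "s = t")
      case False
      have le: "norm (f s - f t - (s - t) *\<^sub>R d t) \<le> e/3 * \<bar>s - t\<bar>"
        "norm (f t - f s - (t - s) *\<^sub>R d s) \<le> e/3 * \<bar>s - t\<bar>"
        using \<delta>(2)[OF s(1) t] \<delta>(2)[OF t s(1)] s(2) by (auto simp: dist_real_def abs_minus_commute)
      have "(s - t) *\<^sub>R (d s - d t) = (f s - f t - (s - t) *\<^sub>R d t) + (f t - f s - (t - s) *\<^sub>R d s)"
        by (simp add: algebra_simps)
      then have "\<bar>s - t\<bar> * norm (d s - d t) \<le> norm (f s - f t - (s - t) *\<^sub>R d t) + norm (f t - f s - (t - s) *\<^sub>R d s)"
        by (metis norm_scaleR norm_triangle_ineq)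
      also have "\<dots> \<le> e/3 * \<bar>s - t\<bar> + e/3 * \<bar>s - t\<bar>"
        by (rule add_mono[OF le])
      also have "\<dots> = \<bar>s - t\<bar> * (2 * e / 3)"
        by simp
      finally have "norm (d s - d t) \<le> 2 * e / 3"
        by (rule mult_left_le_imp_le) (use False in simp)
      then show ?thesis using \<open>0 < e\<close> by (simp add: dist_norm)
    qed (use \<open>0 < e\<close> in simp)
    then show "\<exists>\<delta>>0. \<forall>s\<in>K. dist s t < \<delta> \<longrightarrow> dist (d s) (d t) < e" using \<delta>(1) by blast
  qed
  then obtain h where h: "continuous_on UNIV h" "\<And>t. t \<in> K \<Longrightarrow> h t = d t"
    using Dugundji[of UNIV UNIV K d] compact_imp_closed[OF K(1)] by auto
  define G where "G t = integral {a..t} h" for t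
  have h_ab: "continuous_on {a..b} h" using h(1) continuous_on_subset by blast
  have G: "(G has_vector_derivative h t) (at t within {a..b})" if "t \<in> {a..b}" for t
    unfolding G_def using h_ab that by (rule integral_has_vector_derivative)
  have residual: "\<exists>\<delta>>0. \<forall>s\<in>K. \<forall>t\<in>K. \<bar>s - t\<bar> < \<delta> \<longrightarrow> norm ((f s - G s) - (f t - G t)) \<le> \<epsilon> * \<bar>s - t\<bar>"
    if "0 < \<epsilon>" for \<epsilon>
  proof -
    obtain \<delta>1 where \<delta>1: "0 < \<delta>1" "\<And>s t. s \<in> K \<Longrightarrow> t \<in> K \<Longrightarrow> \<bar>s - t\<bar> < \<delta>1 \<Longrightarrow>
      norm (f s - f t - (s - t) *\<^sub>R d t) \<le> \<epsilon>/2 * \<bar>s - t\<bar>"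
      using f[of "\<epsilon>/2"] \<open>0 < \<epsilon>\<close> by auto
    have "0 < \<epsilon>/2" using \<open>0 < \<epsilon>\<close> by simp
    from C1_uniformly_differentiable[OF G h_ab this]
    obtain \<delta>2 where \<delta>2: "0 < \<delta>2" "\<And>s t. s \<in> {a..b} \<Longrightarrow> t \<in> {a..b} \<Longrightarrow> \<bar>s - t\<bar> < \<delta>2 \<Longrightarrow>
      norm (G s - G t - (s - t) *\<^sub>R h t) \<le> \<epsilon>/2 * \<bar>s - t\<bar>"
      by blast
    have "norm ((f s - G s) - (f t - G t)) \<le> \<epsilon> * \<bar>s - t\<bar>"
      if st: "s \<in> K" "t \<in> K" "\<bar>s - t\<bar> < min \<delta>1 \<delta>2" for s t
    proof -
      have "(f s - G s) - (f t - G t) = (f s - f t - (s - t) *\<^sub>R d t) - (G s - G t - (s - t) *\<^sub>R h t)"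
        by (simp add: h(2)[OF st(2)] algebra_simps)
      also have "norm \<dots> \<le> norm (f s - f t - (s - t) *\<^sub>R d t) + norm (G s - G t - (s - t) *\<^sub>R h t)"
        by (rule norm_triangle_ineq4)
      also have "\<dots> \<le> \<epsilon>/2 * \<bar>s - t\<bar> + \<epsilon>/2 * \<bar>s - t\<bar>"
        using st K(4) by (intro add_mono \<delta>1(2) \<delta>2(2)) auto
      finally show ?thesis by simp
    qed
    then show ?thesis using \<delta>1(1) \<delta>2(1) by (intro exI[of _ "min \<delta>1 \<delta>2"]) auto
  qed
  obtain F H where FH: "continuous_on {a..b} H"
    "\<And>t. t \<in> {a..b} \<Longrightarrow> (F has_vector_derivative H t) (at t within {a..b})"
    "\<And>t. t \<in> K \<Longrightarrow> F t = f t - G t"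
    by (rule C1_extension_with_critical_set[OF K(1-3) residual], assumption, rule that)
  show thesis
  proof (rule that[of "\<lambda>t. H t + h t" "\<lambda>t. F t + G t"])
    show "continuous_on {a..b} (\<lambda>t. H t + h t)"
      using FH(1) h_ab by (rule continuous_on_add)
    show "((\<lambda>t. F t + G t) has_vector_derivative H t + h t) (at t within {a..b})" if "t \<in> {a..b}" for t
      using FH(2)[OF that] G[OF that] by (rule has_vector_derivative_add)
  qed (simp add: FH(3))
qed

section \<open>The arc through the Cantor set\<close>

text \<open>The component along \<open>e\<close> inverts \<open>g\<close> continuously, and its derivative is \<open>1\<close>, so \<open>g'\<close> has no
  zeros.\<close>

lemma C1_arc_of_graph:
  fixes e :: "'a::euclidean_space"
  assumes "a < b" and g': "continuous_on {a..b} g'"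
    and g: "\<And>t. t \<in> {a..b} \<Longrightarrow> (g has_vector_derivative g' t) (at t within {a..b})"
    and ge: "\<And>t. t \<in> {a..b} \<Longrightarrow> g t \<bullet> e = t"
  shows "is_Ck_arc 1 (g ` {a..b})"
proof -
  have "continuous_on {a..b} g"
    unfolding continuous_on_eq_continuous_within
    using has_vector_derivative_continuous[OF g] by blast
  then have hom: "homeomorphism {a..b} (g ` {a..b}) g (\<lambda>x. x \<bullet> e)"
    by (intro homeomorphismI continuous_intros) (auto simp: ge)
  have "vector_derivative g (at t within {a..b}) \<noteq> 0" if t: "t \<in> {a..b}" for t
  proof -
    have "((\<lambda>s. g s \<bullet> e) has_vector_derivative g' t \<bullet> e) (at t within {a..b})"
      using bounded_linear.has_vector_derivative[OF bounded_linear_inner_left g[OF t]] .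
    then have "((\<lambda>s. s) has_vector_derivative g' t \<bullet> e) (at t within {a..b})"
      by (rule has_vector_derivative_transform[OF t, rotated]) (simp add: ge)
    moreover have "((\<lambda>s. s) has_vector_derivative 1) (at t within {a..b})"
      by (rule has_vector_derivative_id)
    ultimately have "g' t \<bullet> e = 1"
      using vector_derivative_within_closed_interval[OF \<open>a < b\<close> t] by metis
    then have "g' t \<noteq> 0" by auto
    then show ?thesis
      using vector_derivative_within_closed_interval[OF \<open>a < b\<close> t g[OF t]] by simp
  qed
  moreover have "is_arc (g ` {a..b})"
    unfolding is_arc_def using \<open>a < b\<close> hom by (meson homeomorphic_def homeomorphic_sym)
  moreover have "Ck_on 1 g {a..b}"
    unfolding One_nat_def Ck_on.simps using g g' by blast
  ultimately show ?thesis
    unfolding is_Ck_arc_def using \<open>a < b\<close> hom by blast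
qed

lemma C1_arc_through_Cantor_set:
  fixes P :: "'a::euclidean_space set"
  assumes "closed P" "uncountable P"
  shows "\<exists>A Q :: 'a set. is_Ck_arc 1 A \<and> is_Cantor_set Q \<and> Q \<subseteq> P \<inter> A"
proof -
  obtain X where X: "X \<subseteq> P" "closed X" "X \<noteq> {}" "\<And>x. x \<in> X \<Longrightarrow> x islimpt X"
    using condensation_points[OF assms] by blast
  obtain e c and d :: "(nat \<Rightarrow> bool) \<Rightarrow> 'a" where e: "e \<in> Basis" and c: "continuous_on UNIV c" "range c \<subseteq> X"
    and inj: "inj (\<lambda>\<beta>. c \<beta> \<bullet> e)" and
    diff: "\<And>\<epsilon>. 0 < \<epsilon> \<Longrightarrow> \<exists>\<delta>>0. \<forall>\<beta> \<gamma> :: nat \<Rightarrow> bool. dist (c \<beta>) (c \<gamma>) < \<delta> \<longrightarrow>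
       norm (c \<gamma> - c \<beta> - ((c \<gamma> - c \<beta>) \<bullet> e) *\<^sub>R d \<beta>) \<le> \<epsilon> * \<bar>(c \<gamma> - c \<beta>) \<bullet> e\<bar>"
    by (rule Cantor_scheme[OF X(2-4)], assumption, rule that)
  \<comment> \<open>The Cantor set is the graph of \<open>f\<close> over its shadow \<open>K\<close> on the axis \<open>e\<close>.\<close>
  define \<pi> where "\<pi> \<beta> = c \<beta> \<bullet> e" for \<beta>
  define K where "K = range \<pi>"
  have \<pi>: "continuous_on UNIV \<pi>" unfolding \<pi>_def using c(1) by (intro continuous_intros)
  have inj_\<pi>: "inj \<pi>" using inj by (simp add: \<pi>_def[abs_def])
  have K: "compact K" unfolding K_def using \<pi> compact_Cantor_space by (rule compact_continuous_image)
  obtain h where "homeomorphism UNIV K \<pi> h"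
    using homeomorphism_compact[OF compact_Cantor_space \<pi> K_def[symmetric] inj_\<pi>] by blast
  then have h: "continuous_on K h" "\<And>\<beta>. h (\<pi> \<beta>) = \<beta>" "\<And>t. t \<in> K \<Longrightarrow> \<pi> (h t) = t"
    by (auto simp: homeomorphism_def)
  have "inj c" using inj by (auto simp: inj_def)
  then obtain k where "homeomorphism UNIV (range c) c k"
    using homeomorphism_compact[OF compact_Cantor_space c(1) refl] by blast
  then have Q: "is_Cantor_set (range c)"
    unfolding is_Cantor_set_def by (meson homeomorphic_def homeomorphic_sym)
  define f where "f t = c (h t)" for t
  have fe: "f t \<bullet> e = t" if "t \<in> K" for t
    using h(3)[OF that] by (simp add: f_def \<pi>_def)
  have "continuous_on K f"
    unfolding f_def using continuous_on_compose2[OF c(1) h(1)] by simp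
  then have unif: "uniformly_continuous_on K f"
    using K by (rule compact_uniformly_continuous)
  have diff_f: "\<exists>\<delta>>0. \<forall>s\<in>K. \<forall>t\<in>K. \<bar>s - t\<bar> < \<delta> \<longrightarrow>
      norm (f s - f t - (s - t) *\<^sub>R d (h t)) \<le> \<epsilon> * \<bar>s - t\<bar>" if "0 < \<epsilon>" for \<epsilon>
  proof -
    obtain \<eta> where \<eta>: "0 < \<eta>" "\<And>\<beta> \<gamma>. dist (c \<beta>) (c \<gamma>) < \<eta> \<Longrightarrow>
       norm (c \<gamma> - c \<beta> - ((c \<gamma> - c \<beta>) \<bullet> e) *\<^sub>R d \<beta>) \<le> \<epsilon> * \<bar>(c \<gamma> - c \<beta>) \<bullet> e\<bar>"
      using diff[OF \<open>0 < \<epsilon>\<close>] by blast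
    obtain \<delta> where \<delta>: "0 < \<delta>" "\<And>s t. s \<in> K \<Longrightarrow> t \<in> K \<Longrightarrow> dist s t < \<delta> \<Longrightarrow> dist (f s) (f t) < \<eta>"
      using unif \<eta>(1) unfolding uniformly_continuous_on_def by metis
    have "norm (f s - f t - (s - t) *\<^sub>R d (h t)) \<le> \<epsilon> * \<bar>s - t\<bar>"
      if "s \<in> K" "t \<in> K" "\<bar>s - t\<bar> < \<delta>" for s t
    proof -
      have "dist (f t) (f s) < \<eta>"
        using \<delta>(2)[OF that(2,1)] that(3) by (simp add: dist_real_def abs_minus_commute)
      then show ?thesis
        using \<eta>(2)[of "h t" "h s"] fe that(1,2) by (simp add: f_def inner_diff_left)
    qed
    then show ?thesis using \<delta>(1) by blast
  qed
  define a b where "a = Inf K" and "b = Sup K"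
  have "K \<noteq> {}" by (simp add: K_def)
  then have ab: "a \<in> K" "b \<in> K"
    unfolding a_def b_def using K
    by (auto intro!: closed_contains_Inf closed_contains_Sup bounded_imp_bdd_below bounded_imp_bdd_above
        simp: compact_imp_closed compact_imp_bounded)
  have sub: "K \<subseteq> {a..b}"
    unfolding a_def b_def using compact_imp_bounded[OF K]
    by (auto intro!: cInf_lower cSup_upper bounded_imp_bdd_below bounded_imp_bdd_above)
  have "a < b"
  proof -
    have "\<pi> (\<lambda>_. True) \<noteq> \<pi> (\<lambda>_. False)" using inj_\<pi> by (metis injD)
    moreover have "\<pi> \<beta> \<in> {a..b}" for \<beta> using sub unfolding K_def by blast
    ultimately show ?thesis by (metis atLeastAtMost_iff order_antisym order_trans not_le)
  qed
  obtain g g' where g: "continuous_on {a..b} g'"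
    "\<And>t. t \<in> {a..b} \<Longrightarrow> (g has_vector_derivative g' t) (at t within {a..b})"
    "\<And>t. t \<in> K \<Longrightarrow> g t = f t"
    by (rule Whitney_extension_C1[OF K ab sub diff_f], assumption, rule that)
  have ee: "e \<bullet> e = 1" using e by simp
  \<comment> \<open>The extension need not be a graph; adjust its \<open>e\<close>-component, which is already right on \<open>K\<close>.\<close>
  define \<gamma> where "\<gamma> t = g t + (t - g t \<bullet> e) *\<^sub>R e" for t
  define \<gamma>' where "\<gamma>' t = g' t + (1 - g' t \<bullet> e) *\<^sub>R e" for t
  have "is_Ck_arc 1 (\<gamma> ` {a..b})"
  proof (rule C1_arc_of_graph[OF \<open>a < b\<close>])
    show "continuous_on {a..b} \<gamma>'"
      unfolding \<gamma>'_def by (intro continuous_intros g(1))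
    show "(\<gamma> has_vector_derivative \<gamma>' t) (at t within {a..b})" if "t \<in> {a..b}" for t
    proof -
      have "((\<lambda>s. g s \<bullet> e) has_vector_derivative g' t \<bullet> e) (at t within {a..b})"
        using bounded_linear.has_vector_derivative[OF bounded_linear_inner_left g(2)[OF that]] .
      then have "((\<lambda>s. s - g s \<bullet> e) has_vector_derivative 1 - g' t \<bullet> e) (at t within {a..b})"
        by (intro has_vector_derivative_diff has_vector_derivative_id)
      then have "((\<lambda>s. (s - g s \<bullet> e) *\<^sub>R e) has_vector_derivative (1 - g' t \<bullet> e) *\<^sub>R e) (at t within {a..b})"
        by (rule bounded_linear.has_vector_derivative[OF bounded_linear_scaleR_left])
      then show ?thesis
        unfolding \<gamma>_def \<gamma>'_def by (intro has_vector_derivative_add g(2) that)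
    qed
    show "\<gamma> t \<bullet> e = t" for t
      by (simp add: \<gamma>_def inner_add_left ee)
  qed
  moreover have "range c \<subseteq> P \<inter> \<gamma> ` {a..b}"
  proof -
    have "c \<beta> = \<gamma> (\<pi> \<beta>)" "\<pi> \<beta> \<in> {a..b}" for \<beta>
    proof -
      have "\<pi> \<beta> \<in> K" by (simp add: K_def)
      then show "\<pi> \<beta> \<in> {a..b}" using sub by blast
      have "g (\<pi> \<beta>) = c \<beta>" using g(3)[OF \<open>\<pi> \<beta> \<in> K\<close>] h(2) by (simp add: f_def)
      then show "c \<beta> = \<gamma> (\<pi> \<beta>)" by (simp add: \<gamma>_def \<pi>_def)
    qed
    then show ?thesis using X(1) c(2) by blast
  qed
  ultimately show ?thesis using Q by blast
qed

section \<open>Directed subarcs\<close>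

text \<open>Near \<open>t0\<close> all difference quotients are close to \<open>g' t0\<close>, where the radial projection is
  continuous. The two signs in the definition of a directed set come from the two orders of the
  parameters.\<close>

lemma C1_path_locally_directed:
  fixes g :: "real \<Rightarrow> real^'n"
  assumes g: "\<And>t. t \<in> {a..b} \<Longrightarrow> (g has_vector_derivative g' t) (at t within {a..b})"
    and g': "continuous_on {a..b} g'" and t0: "t0 \<in> {a..b}" "g' t0 \<noteq> 0" and "0 < \<epsilon>"
  shows "\<exists>\<delta>>0. directed_set \<epsilon> (g ` ({a..b} \<inter> cball t0 \<delta>))"
proof -
  define v where "v = sgn (g' t0)"
  have v: "v \<in> sphere 0 1" using t0(2) by (simp add: v_def norm_sgn)
  have "isCont (\<lambda>x :: real^'n. sgn x) (g' t0)" using t0(2) by (intro continuous_intros)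
  then obtain \<eta> where \<eta>: "0 < \<eta>" "\<And>x. dist x (g' t0) < \<eta> \<Longrightarrow> dist (sgn x) v < \<epsilon>"
    using \<open>0 < \<epsilon>\<close> unfolding continuous_at_eps_delta v_def by blast
  obtain \<delta>1 where \<delta>1: "0 < \<delta>1" "\<And>t. t \<in> {a..b} \<Longrightarrow> dist t t0 < \<delta>1 \<Longrightarrow> dist (g' t) (g' t0) < \<eta>/3"
    using g' t0(1) \<eta>(1) unfolding continuous_on_iff by (metis divide_pos_pos zero_less_numeral)
  obtain \<delta>2 where \<delta>2: "0 < \<delta>2" "\<And>s t. s \<in> {a..b} \<Longrightarrow> t \<in> {a..b} \<Longrightarrow> \<bar>s - t\<bar> < \<delta>2 \<Longrightarrow>
    norm (g s - g t - (s - t) *\<^sub>R g' t) \<le> \<eta>/3 * \<bar>s - t\<bar>"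
    using C1_uniformly_differentiable[OF g g', of "\<eta>/3"] \<eta>(1) by auto
  define \<delta> where "\<delta> = min \<delta>1 \<delta>2 / 3"
  have \<delta>: "0 < \<delta>" "\<delta> < \<delta>1" "2 * \<delta> < \<delta>2" using \<delta>1(1) \<delta>2(1) by (auto simp: \<delta>_def min_def)
  have forward: "norm (sgn (g s - g t) - v) \<le> \<epsilon>"
    if st: "s \<in> {a..b} \<inter> cball t0 \<delta>" "t \<in> {a..b} \<inter> cball t0 \<delta>" "t < s" for s t
  proof -
    define q where "q = (g s - g t) /\<^sub>R (s - t)"
    have "\<bar>s - t\<bar> < \<delta>2" using st \<delta>(3) by (auto simp: dist_real_def)
    then have "norm (g s - g t - (s - t) *\<^sub>R g' t) \<le> \<eta>/3 * (s - t)" using \<delta>2(2)[of s t] st by auto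
    moreover have "g s - g t - (s - t) *\<^sub>R g' t = (s - t) *\<^sub>R (q - g' t)"
      using st(3) by (simp add: q_def scaleR_diff_right)
    ultimately have "norm (q - g' t) \<le> \<eta>/3"
      using st(3) by (simp add: mult.commute)
    moreover have "dist (g' t) (g' t0) < \<eta>/3"
      using \<delta>1(2)[of t] st(2) \<delta>(2) by (auto simp: dist_commute)
    ultimately have "dist q (g' t0) < \<eta>"
      using dist_triangle[of q "g' t0" "g' t"] \<eta>(1) by (simp add: dist_norm)
    then have "dist (sgn q) v < \<epsilon>" by (rule \<eta>(2))
    moreover have "sgn q = sgn (g s - g t)"
      using st(3) by (simp add: q_def sgn_scaleR)
    ultimately show ?thesis by (simp add: dist_norm)
  qed
  have "norm (sgn (g s - g t) - v) \<le> \<epsilon> \<or> norm (sgn (g s - g t) + v) \<le> \<epsilon>"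
    if st: "s \<in> {a..b} \<inter> cball t0 \<delta>" "t \<in> {a..b} \<inter> cball t0 \<delta>" "g s \<noteq> g t" for s t
  proof (cases "t < s")
    case True
    then show ?thesis using forward st by blast
  next
    case False
    with st(3) have "s < t" by (metis not_less_iff_gr_or_eq)
    then have "norm (sgn (g t - g s) - v) \<le> \<epsilon>" using forward st by blast
    moreover have "sgn (g t - g s) - v = - (sgn (g s - g t) + v)"
      using sgn_minus[of "g s - g t"] by simp
    ultimately show ?thesis by (metis norm_minus_cancel)
  qed
  then have "directed_set \<epsilon> (g ` ({a..b} \<inter> cball t0 \<delta>))"
    unfolding directed_set_def using v by blast
  with \<delta>(1) show ?thesis by blast
qed

text \<open>Finitely many directed pieces cover the arc, so one of them contains uncountably many points
  of \<open>P\<close>.\<close>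

lemma directed_subarc:
  fixes A P :: "(real^'n) set"
  assumes "is_Ck_arc 1 A" "uncountable (P \<inter> A)" "0 < \<epsilon>"
  shows "\<exists>B\<subseteq>A. is_arc B \<and> directed_set \<epsilon> B \<and> uncountable (P \<inter> B)"
proof -
  obtain a b g h where "a < b" and hom: "homeomorphism {a..b} A g h" and C1: "Ck_on 1 g {a..b}"
    and nz: "\<forall>t\<in>{a..b}. vector_derivative g (at t within {a..b}) \<noteq> 0"
    using assms(1) unfolding is_Ck_arc_def by blast
  obtain g' where g': "\<And>t. t \<in> {a..b} \<Longrightarrow> (g has_vector_derivative g' t) (at t within {a..b})" "continuous_on {a..b} g'"
    using C1 unfolding One_nat_def Ck_on.simps by blast
  have "g' t \<noteq> 0" if "t \<in> {a..b}" for t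
    using nz that vector_derivative_within_closed_interval[OF \<open>a < b\<close> that g'(1)[OF that]] by auto
  then have "\<exists>\<delta>>0. directed_set \<epsilon> (g ` ({a..b} \<inter> cball t \<delta>))" if "t \<in> {a..b}" for t
    using C1_path_locally_directed[OF g' that] that assms(3) by blast
  then obtain \<delta> where \<delta>: "\<And>t. t \<in> {a..b} \<Longrightarrow> 0 < \<delta> t \<and> directed_set \<epsilon> (g ` ({a..b} \<inter> cball t (\<delta> t)))"
    by metis
  have "{a..b} \<subseteq> (\<Union>t\<in>{a..b}. ball t (\<delta> t))" using \<delta> by force
  then obtain T where T: "T \<subseteq> {a..b}" "finite T" "{a..b} \<subseteq> (\<Union>t\<in>T. ball t (\<delta> t))"
    using compactE_image[OF compact_Icc[of a b], of "{a..b}" "\<lambda>t. ball t (\<delta> t)"] by auto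
  have "P \<inter> A \<subseteq> (\<Union>t\<in>T. P \<inter> g ` ({a..b} \<inter> cball t (\<delta> t)))"
  proof
    fix x assume x: "x \<in> P \<inter> A"
    then obtain s where s: "s \<in> {a..b}" "x = g s" using hom by (auto simp: homeomorphism_def)
    then obtain t where t: "t \<in> T" "s \<in> ball t (\<delta> t)" using T(3) by blast
    then have "s \<in> {a..b} \<inter> cball t (\<delta> t)" using s(1) by auto
    with x s(2) t(1) show "x \<in> (\<Union>t\<in>T. P \<inter> g ` ({a..b} \<inter> cball t (\<delta> t)))" by blast
  qed
  then have "\<not> (\<forall>t\<in>T. countable (P \<inter> g ` ({a..b} \<inter> cball t (\<delta> t))))"
    using assms(2) T(2) by (meson countable_UN countable_finite countable_subset)
  then obtain t where t: "t \<in> T" "uncountable (P \<inter> g ` ({a..b} \<inter> cball t (\<delta> t)))" by blast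
  define I where "I = {a..b} \<inter> cball t (\<delta> t)"
  have tab: "t \<in> {a..b}" "0 < \<delta> t" using t(1) T(1) \<delta> by auto
  then have I: "I = {max a (t - \<delta> t)..min b (t + \<delta> t)}" "max a (t - \<delta> t) < min b (t + \<delta> t)"
    using \<open>a < b\<close> by (auto simp: I_def dist_real_def)
  have "homeomorphism I (g ` I) g h"
    by (rule homeomorphism_of_subsets[OF hom, of _ "{}"]) (auto simp: I_def)
  then have "is_arc (g ` I)"
    unfolding is_arc_def using I by (metis homeomorphic_def homeomorphic_sym)
  moreover have "g ` I \<subseteq> A" using hom by (auto simp: I_def homeomorphism_def)
  ultimately show ?thesis using t \<delta>[OF tab(1)] unfolding I_def by blast
qed

theorem theorem1p3:
  fixes P :: "(real^'n) set"
  assumes "closed P" and "uncountable P"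
  shows "(\<exists>A Q :: (real^'n) set. is_Ck_arc 1 A \<and> is_Cantor_set Q \<and> Q \<subseteq> P \<inter> A) \<and>
         (\<forall>\<epsilon>::real. \<epsilon> > 0 \<longrightarrow>
            (\<exists>B :: (real^'n) set. is_arc B \<and> directed_set \<epsilon> B \<and> uncountable (P \<inter> B)))"
proof (intro conjI allI impI)
  show arc: "\<exists>A Q :: (real^'n) set. is_Ck_arc 1 A \<and> is_Cantor_set Q \<and> Q \<subseteq> P \<inter> A"
    using assms by (rule C1_arc_through_Cantor_set)
  fix \<epsilon> :: real assume "0 < \<epsilon>"
  obtain A Q :: "(real^'n) set" where A: "is_Ck_arc 1 A" and Q: "is_Cantor_set Q" "Q \<subseteq> P \<inter> A"
    using arc by blast
  have "uncountable (P \<inter> A)"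
    using uncountable_Cantor_set[OF Q(1)] Q(2) countable_subset by blast
  then show "\<exists>B :: (real^'n) set. is_arc B \<and> directed_set \<epsilon> B \<and> uncountable (P \<inter> B)"
    using directed_subarc[OF A _ \<open>0 < \<epsilon>\<close>] by blast
qed

end
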